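(* Let $p,q$ be complex numbers with $p\neq0$, $q\neq0$, $p^2-4q\neq0$, and let $(u_n),(v_n),(w_n)$ be as in the context. Let $r,k,s$ be integers and $z$ a complex number with $q^r z^2 - v_r z + 1\neq 0$. Then \[ \sum_{j = 0}^k u_{rj + s}z^j = \frac{q^r u_{rk + s} z^{k + 2} - u_{rk + r + s} z^{k + 1} + q^s u_{r - s}z + u_s }{q^r z^2 - v_r z + 1}\,, \] \[ \sum_{j = 0}^k v_{rj + s} z^j = \frac{q^r v_{rk + s} z^{k + 2} - v_{rk + r + s} z^{k + 1} - q^s v_{r-s}z + v_s }{q^r z^2 - v_r z + 1}\,, \] \[ \sum_{j = 0}^k w_{rj + s} z^j = \frac{q^r w_{rk + s} z^{k + 2} - w_{rk + r + s} z^{k + 1} - q^rw_{s-r}z + w_s }{q^r z^2 - v_r z + 1}\,. \]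
   Context: For complex numbers $a,b,p,q$ with $p\neq0,q\neq0$, the Horadam sequence $(w_n)=(w_n(a,b;p,q))$ is defined by $w_0=a$, $w_1=b$, $w_n=pw_{n-1}-qw_{n-2}$, extended to all integers $n$ by running the recurrence backwards. The Lucas sequences are $u_n=w_n(0,1;p,q)$ and $v_n=w_n(2,p;p,q)$. Let $\alpha,\beta$ be the (distinct, since $p^2-4q\neq0$) roots of $x^2-px+q$, so $\alpha+\beta=p$, $\alpha\beta=q$; then $u_n=(\alpha^n-\beta^n)/(\alpha-\beta)$, $v_n=\alpha^n+\beta^n$ for all integers $n$. *)

theory Defs
  imports Complex_Main
begin

text \<open>
  The Horadam sequence over all integers. The last branch is the recurrence
  solved for the term of smallest index, so it is meaningful only for \<open>q \<noteq> 0\<close>.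
\<close>

function horadam :: "complex \<Rightarrow> complex \<Rightarrow> complex \<Rightarrow> complex \<Rightarrow> int \<Rightarrow> complex" where
  "horadam a b p q n =
    (if n = 0 then a
     else if n = 1 then b
     else if n > 1 then p * horadam a b p q (n - 1) - q * horadam a b p q (n - 2)
     else (p * horadam a b p q (n + 1) - horadam a b p q (n + 2)) / q)"
  by pat_completeness auto
termination
  by (relation "measure (\<lambda>(a, b, p, q, n). nat \<bar>2 * n - 1\<bar>)") auto

declare horadam.simps [simp del]

lemma horadam_0: "horadam a b p q 0 = a"
  by (simp add: horadam.simps)

lemma horadam_1: "horadam a b p q 1 = b"
  by (simp add: horadam.simps)

lemma horadam_rec:
  assumes "q \<noteq> 0"
  shows "horadam a b p q n = p * horadam a b p q (n - 1) - q * horadam a b p q (n - 2)"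
proof (cases "n > 1")
  case True
  then show ?thesis
    by (subst horadam.simps) simp
next
  case False
  then have "horadam a b p q (n - 2) = (p * horadam a b p q (n - 1) - horadam a b p q n) / q"
    by (subst horadam.simps) simp
  with assms show ?thesis
    by simp
qed

definition lucas_u :: "complex \<Rightarrow> complex \<Rightarrow> int \<Rightarrow> complex" where
  "lucas_u p q n = horadam 0 1 p q n"

definition lucas_v :: "complex \<Rightarrow> complex \<Rightarrow> int \<Rightarrow> complex" where
  "lucas_v p q n = horadam 2 p p q n"

text \<open>
  The sum of \<open>f j\<close> for \<open>j\<close> from \<open>0\<close> to an arbitrary integer \<open>k\<close>. For \<open>k \<ge> 0\<close> this is the
  ordinary sum, for \<open>k = -1\<close> it is empty, and for \<open>k < -1\<close> it follows the usual convention
  for reversed limits, the only one compatible with \<open>sum_upto_step\<close> for all \<open>k\<close>.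
\<close>

definition sum_upto :: "(int \<Rightarrow> complex) \<Rightarrow> int \<Rightarrow> complex" where
  "sum_upto f k = (if k \<ge> 0 then (\<Sum>j = 0..k. f j) else - (\<Sum>j = k + 1..- 1. f j))"

lemma sum_upto_nonneg: "k \<ge> 0 \<Longrightarrow> sum_upto f k = (\<Sum>j = 0..k. f j)"
  by (simp add: sum_upto_def)

lemma sum_upto_step: "sum_upto f (k + 1) = sum_upto f k + f (k + 1)"
proof -
  consider "k \<ge> 0" | "k = - 1" | "k < - 1" by linarith
  then show ?thesis
  proof cases
    case 1
    then have "{0..k + 1} = insert (k + 1) {0..k}" by auto
    with 1 show ?thesis by (simp add: sum_upto_def)
  next
    case 2
    then show ?thesis by (simp add: sum_upto_def)
  next
    case 3
    then have "{k + 1..- 1} = insert (k + 1) {k + 1 + 1..- 1}" by auto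
    with 3 show ?thesis by (simp add: sum_upto_def)
  qed
qed

end

(* A solution of the recurrence is determined by two consecutive values. In r, both sides of
   w(n + r) + q^r w(n - r) = v(r) w(n) solve the recurrence, so this identity holds; it says exactly
   that the claimed closed form, times its denominator, telescopes in k. At k = -1 both sides of the
   formula vanish, so induction in both directions from there covers every integer k. The formulas
   for u and v are the one for w, rewritten by the reflections q^n u(-n) = -u(n), q^n v(-n) = v(n). *)
theory Submission
  imports Defs
begin

text \<open>Solutions are closed under sums, constant factors, shifts and weighted reflections, so
  an identity between such expressions reduces to two initial values.\<close>

definition horadam_recurrence :: "complex \<Rightarrow> complex \<Rightarrow> (int \<Rightarrow> complex) \<Rightarrow> bool" where
  "horadam_recurrence p q f \<longleftrightarrow> (\<forall>n. f n = p * f (n - 1) - q * f (n - 2))"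

lemma horadam_recurrence_horadam:
  "q \<noteq> 0 \<Longrightarrow> horadam_recurrence p q (horadam a b p q)"
  unfolding horadam_recurrence_def using horadam_rec by blast

text \<open>Two-sided induction on pairs of consecutive values. Going down, the recurrence is solved
  for its smallest term, and this divides by \<open>q\<close>.\<close>

lemma horadam_recurrence_unique:
  assumes "q \<noteq> 0" and f: "horadam_recurrence p q f" and g: "horadam_recurrence p q g"
    and "f 0 = g 0" and "f 1 = g 1"
  shows "f n = g n"
proof -
  have "f n = g n \<and> f (n + 1) = g (n + 1)"
  proof (induction n rule: int_induct[where k = 0])
    case base
    from assms show ?case by simp
  next
    case (step1 i)
    have "f (i + 2) = p * f (i + 1) - q * f i" "g (i + 2) = p * g (i + 1) - q * g i"
      using f[unfolded horadam_recurrence_def, rule_format, of "i + 2"]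
        g[unfolded horadam_recurrence_def, rule_format, of "i + 2"] by (simp_all add: add.commute)
    with step1 show ?case by (simp add: add.assoc)
  next
    case (step2 i)
    have "f (i + 1) = p * f i - q * f (i - 1)" "g (i + 1) = p * g i - q * g (i - 1)"
      using f[unfolded horadam_recurrence_def, rule_format, of "i + 1"]
        g[unfolded horadam_recurrence_def, rule_format, of "i + 1"] by (simp_all add: add.commute)
    with step2 \<open>q \<noteq> 0\<close> show ?case by auto
  qed
  then show ?thesis ..
qed

lemma horadam_recurrence_shift:
  "horadam_recurrence p q f \<Longrightarrow> horadam_recurrence p q (\<lambda>r. f (n + r))"
  unfolding horadam_recurrence_def by (metis add_diff_eq)

lemma horadam_recurrence_add:
  "horadam_recurrence p q f \<Longrightarrow> horadam_recurrence p q g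
    \<Longrightarrow> horadam_recurrence p q (\<lambda>r. f r + g r)"
  unfolding horadam_recurrence_def
proof
  fix n
  assume "\<forall>n. f n = p * f (n - 1) - q * f (n - 2)" and "\<forall>n. g n = p * g (n - 1) - q * g (n - 2)"
  then have "f n = p * f (n - 1) - q * f (n - 2)" "g n = p * g (n - 1) - q * g (n - 2)"
    by blast+
  then show "f n + g n = p * (f (n - 1) + g (n - 1)) - q * (f (n - 2) + g (n - 2))"
    by algebra
qed

lemma horadam_recurrence_mult_right:
  "horadam_recurrence p q f \<Longrightarrow> horadam_recurrence p q (\<lambda>r. f r * c)"
  unfolding horadam_recurrence_def by (metis left_diff_distrib mult.assoc)

text \<open>Reversing the index exchanges the coefficients of the outer terms; the weight
  \<open>q powi r\<close> restores them. In terms of the roots, q^r \<alpha>^(-r) = \<beta>^r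
  because \<alpha>\<beta> = q.\<close>

lemma horadam_recurrence_reflect:
  assumes "q \<noteq> 0" and f: "horadam_recurrence p q f"
  shows "horadam_recurrence p q (\<lambda>r. q powi r * f (n - r))"
  unfolding horadam_recurrence_def
proof
  fix r
  have 1: "f (n - (r - 2)) = p * f (n - (r - 1)) - q * f (n - r)"
    using f[unfolded horadam_recurrence_def, rule_format, of "n - (r - 2)"]
    by (simp add: algebra_simps)
  have 2: "q powi (r - 1) = q powi (r - 2) * q" "q powi r = q powi (r - 2) * q * q"
    using \<open>q \<noteq> 0\<close> power_int_add_1[of q "r - 2"] power_int_add_1[of q "r - 1"]
    by simp_all
  show "q powi r * f (n - r) =
      p * (q powi (r - 1) * f (n - (r - 1))) - q * (q powi (r - 2) * f (n - (r - 2)))"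
    unfolding 1 2 by (simp add: algebra_simps)
qed

lemma horadam_add_diff:
  assumes "q \<noteq> 0"
  shows "horadam a b p q (n + r) + q powi r * horadam a b p q (n - r) =
    lucas_v p q r * horadam a b p q n"
proof -
  let ?w = "horadam a b p q"
  have w: "horadam_recurrence p q ?w"
    using assms by (rule horadam_recurrence_horadam)
  show ?thesis
  proof (rule horadam_recurrence_unique[where p = p and q = q and n = r])
    show "horadam_recurrence p q (\<lambda>r. ?w (n + r) + q powi r * ?w (n - r))"
      using assms w
      by (intro horadam_recurrence_add horadam_recurrence_shift horadam_recurrence_reflect)
    show "horadam_recurrence p q (\<lambda>r. lucas_v p q r * ?w n)"
      unfolding lucas_v_def
      using assms by (intro horadam_recurrence_mult_right horadam_recurrence_horadam)
    \<comment> \<open>With v(1) = p this is the recurrence at n + 1. At r = 0 both sides are 2 w(n),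
      which is where v(0) = 2 enters.\<close>
    show "?w (n + 1) + q powi 1 * ?w (n - 1) = lucas_v p q 1 * ?w n"
      using horadam_rec[OF assms, of a b p "n + 1"] by (simp add: lucas_v_def horadam_1)
  qed (use assms in \<open>simp_all add: lucas_v_def horadam_0\<close>)
qed

text \<open>The reflected sequence solves the same recurrence, and its value at 1 is q w(-1) = p
  w(0) - w(1). Thus initial values (0, 1) become (0, -1), while (2, p) stay fixed.\<close>

lemma horadam_reflect:
  assumes "q \<noteq> 0"
  shows "q powi n * horadam a b p q (- n) = horadam a (p * a - b) p q n"
proof (rule horadam_recurrence_unique[where p = p and q = q and n = n])
  show "horadam_recurrence p q (\<lambda>n. q powi n * horadam a b p q (- n))"
    using horadam_recurrence_reflect[OF assms horadam_recurrence_horadam[OF assms], of p a b 0]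
    by simp
  show "q powi 1 * horadam a b p q (- 1) = horadam a (p * a - b) p q 1"
    using horadam_rec[OF assms, of a b p 1] by (simp add: horadam_0 horadam_1 algebra_simps)
qed (use assms in \<open>simp_all add: horadam_0 horadam_recurrence_horadam\<close>)

lemma lucas_u_reflect:
  assumes "q \<noteq> 0"
  shows "q powi n * lucas_u p q (- n) = - lucas_u p q n"
proof -
  have "horadam 0 (- 1) p q n = horadam 0 1 p q n * (- 1)"
  proof (rule horadam_recurrence_unique[where p = p and q = q and n = n])
    show "horadam_recurrence p q (\<lambda>n. horadam 0 1 p q n * (- 1))"
      using assms by (intro horadam_recurrence_mult_right horadam_recurrence_horadam)
  qed (use assms in \<open>simp_all add: horadam_0 horadam_1 horadam_recurrence_horadam\<close>)
  then show ?thesis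
    using horadam_reflect[OF assms, of n 0 1 p] by (simp add: lucas_u_def)
qed

lemma lucas_v_reflect:
  assumes "q \<noteq> 0"
  shows "q powi n * lucas_v p q (- n) = lucas_v p q n"
  using horadam_reflect[OF assms, of n 2 p p] by (simp add: lucas_v_def mult_2_right)

text \<open>The anchor is the empty sum at -1. \<open>P\<close> licenses the downward direction; it
  will be \<open>z \<noteq> 0\<close>, since negative powers of 0 are only a default value.\<close>

lemma sum_upto_eqI:
  assumes "F (- 1) = 0"
    and F_step: "\<And>k. P \<or> k \<ge> - 1 \<Longrightarrow> F (k + 1) = F k + f (k + 1)"
    and "P \<or> k \<ge> - 1"
  shows "sum_upto f k = F k"
proof (cases "k \<ge> - 1")
  case True
  then show ?thesis
  proof (induction rule: int_ge_induct)
    case base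
    from assms(1) show ?case by (simp add: sum_upto_def)
  next
    case (step i)
    then show ?case
      using F_step[of i] by (simp add: sum_upto_step)
  qed
next
  case False
  with assms(3) have P and "k \<le> - 1" by simp_all
  from this(2) show ?thesis
  proof (induction rule: int_le_induct)
    case base
    from assms(1) show ?case by (simp add: sum_upto_def)
  next
    case (step i)
    \<comment> \<open>The step from i - 1 to i is read backwards; as i - 1 < -1, it is available
      only through \<open>P\<close>.\<close>
    then show ?case
      using F_step[of "i - 1"] \<open>P\<close> sum_upto_step[of f "i - 1"] by simp
  qed
qed

lemma sum_upto_horadam:
  fixes a b p q z :: complex and r k s :: int
  assumes "q \<noteq> 0" and D: "q powi r * z\<^sup>2 - lucas_v p q r * z + 1 \<noteq> 0"
    and "z \<noteq> 0 \<or> k \<ge> - 1"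
  shows "sum_upto (\<lambda>j. horadam a b p q (r * j + s) * z powi j) k =
      (q powi r * horadam a b p q (r * k + s) * z powi (k + 2)
        - horadam a b p q (r * k + r + s) * z powi (k + 1)
        - q powi r * horadam a b p q (s - r) * z + horadam a b p q s)
      / (q powi r * z\<^sup>2 - lucas_v p q r * z + 1)"
    (is "_ = ?N k / ?D")
proof (rule sum_upto_eqI[where P = "z \<noteq> 0" and F = "\<lambda>k. ?N k / ?D"])
  \<comment> \<open>The four terms cancel in pairs; \<open>z powi 0 = 1\<close> holds for z = 0 as
    well.\<close>
  show "?N (- 1) / ?D = 0" by simp
next
  fix k :: int
  assume k: "z \<noteq> 0 \<or> k \<ge> - 1"
  \<comment> \<open>\<open>m\<close> is the index of the summand that is added in passing from k to
    k + 1; the other indices become m - r and m + r.\<close>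
  define m where "m = r * k + r + s"
  have idx: "r * k + s = m - r" "r * (k + 1) + s = m" "r * (k + 1) + r + s = m + r"
    "r * k + r + s = m" "k + 1 + 2 = k + 3" "k + 1 + 1 = k + 2"
    by (simp_all add: m_def algebra_simps)
  \<comment> \<open>For z = 0 the law z^(n+1) = z^n z fails only at n = -1. In that case k \<ge> -1,
    so both exponents n are nonnegative.\<close>
  have "z powi (k + 1 + 1) = z powi (k + 1) * z" "z powi (k + 2 + 1) = z powi (k + 2) * z"
    by (rule power_int_add_1; use k in linarith)+
  then have pow: "z powi (k + 2) = z powi (k + 1) * z" "z powi (k + 3) = z powi (k + 1) * z * z"
    by (simp_all add: add.commute)
  \<comment> \<open>In the difference of the numerators, z^(k+2) has the coefficient -(w(m + r) +
    q^r w(m - r)) = -v(r) w(m), so that w(m) z^(k+1) factors out and leaves the denominator.\<close>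
  have "?N (k + 1) = ?N k + horadam a b p q m * z powi (k + 1) * ?D"
    unfolding idx pow using horadam_add_diff[OF \<open>q \<noteq> 0\<close>, of a b p m r] by algebra
  then have "?N (k + 1) / ?D = (?N k + horadam a b p q m * z powi (k + 1) * ?D) / ?D"
    by (rule arg_cong)
  also have "\<dots> = ?N k / ?D + horadam a b p q (r * (k + 1) + s) * z powi (k + 1)"
    unfolding idx(2) add_divide_distrib using D by simp
  finally show "?N (k + 1) / ?D =
      ?N k / ?D + horadam a b p q (r * (k + 1) + s) * z powi (k + 1)" .
qed fact

theorem theorem1:
  fixes a b p q z :: complex and r k s :: int
  assumes "p \<noteq> 0" and "q \<noteq> 0" and "p\<^sup>2 - 4 * q \<noteq> 0"
    and "q powi r * z\<^sup>2 - lucas_v p q r * z + 1 \<noteq> 0"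
    and "z \<noteq> 0 \<or> k \<ge> - 1"
  shows
    "sum_upto (\<lambda>j. lucas_u p q (r * j + s) * z powi j) k =
      (q powi r * lucas_u p q (r * k + s) * z powi (k + 2)
        - lucas_u p q (r * k + r + s) * z powi (k + 1)
        + q powi s * lucas_u p q (r - s) * z + lucas_u p q s)
      / (q powi r * z\<^sup>2 - lucas_v p q r * z + 1)
     \<and> sum_upto (\<lambda>j. lucas_v p q (r * j + s) * z powi j) k =
      (q powi r * lucas_v p q (r * k + s) * z powi (k + 2)
        - lucas_v p q (r * k + r + s) * z powi (k + 1)
        - q powi s * lucas_v p q (r - s) * z + lucas_v p q s)
      / (q powi r * z\<^sup>2 - lucas_v p q r * z + 1)
     \<and> sum_upto (\<lambda>j. horadam a b p q (r * j + s) * z powi j) k =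
      (q powi r * horadam a b p q (r * k + s) * z powi (k + 2)
        - horadam a b p q (r * k + r + s) * z powi (k + 1)
        - q powi r * horadam a b p q (s - r) * z + horadam a b p q s)
      / (q powi r * z\<^sup>2 - lucas_v p q r * z + 1)"
proof (intro conjI)
  \<comment> \<open>Splitting off q^(s-r) prepares the reflection at s - r, which turns the index r
    - s into s - r. The sign it gives for u, but not for v, explains the differing signs of the
    linear terms.\<close>
  have q: "q powi s = q powi r * q powi (s - r)"
    using \<open>q \<noteq> 0\<close> power_int_add[of q r "s - r"] by simp
  have u: "q powi s * lucas_u p q (r - s) = - (q powi r * lucas_u p q (s - r))"
    using lucas_u_reflect[OF \<open>q \<noteq> 0\<close>, of "s - r" p] by (simp add: q mult.assoc)
  have v: "q powi s * lucas_v p q (r - s) = q powi r * lucas_v p q (s - r)"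
    using lucas_v_reflect[OF \<open>q \<noteq> 0\<close>, of "s - r" p] by (simp add: q mult.assoc)
  note sum_w = sum_upto_horadam[OF assms(2,4,5)]
  show "sum_upto (\<lambda>j. lucas_u p q (r * j + s) * z powi j) k =
      (q powi r * lucas_u p q (r * k + s) * z powi (k + 2)
        - lucas_u p q (r * k + r + s) * z powi (k + 1)
        + q powi s * lucas_u p q (r - s) * z + lucas_u p q s)
      / (q powi r * z\<^sup>2 - lucas_v p q r * z + 1)"
    unfolding u using sum_w[of 0 1 s] by (simp flip: lucas_u_def)
  show "sum_upto (\<lambda>j. lucas_v p q (r * j + s) * z powi j) k =
      (q powi r * lucas_v p q (r * k + s) * z powi (k + 2)
        - lucas_v p q (r * k + r + s) * z powi (k + 1)
        - q powi s * lucas_v p q (r - s) * z + lucas_v p q s)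
      / (q powi r * z\<^sup>2 - lucas_v p q r * z + 1)"
    unfolding v using sum_w[of 2 p s] by (simp flip: lucas_v_def)
qed (rule sum_upto_horadam[OF assms(2,4,5)])

end
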